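(* Let $K$ be a compact Hausdorff space such that $C_p(K)$ is Lindelöf. Then $K$ has the Bishop property.
   Context: For a compact Hausdorff space $K$, $C(K)$ is the Banach space of all scalar-valued (real or complex) continuous functions on $K$ with the supremum norm, and $C_p(K)$ denotes $C(K)$ equipped with the topology of pointwise convergence on $K$. For $f\in C(K)$, $\operatorname{supp} f$ is the closure of $\{t\in K: f(t)\neq 0\}$. For distinct $f,g\in C(K)$ write $f\prec g$ if $f$ and $g$ agree on $\operatorname{supp} f$; this is a strict partial order. A subset $F\subseteq C(K)$ is a $\prec$-chain if for all distinct $f,g\in F$ either $f\prec g$ or $g\prec f$. The space $K$ has the Bishop property if $\inf\{\|f-g\| : f,g\in F,\ f\prec g\}=0$ for every norm-bounded uncountable $\prec$-chain $F$ in $C(K)$. *)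

theory Defs
  imports "HOL-Analysis.Analysis"
begin

text \<open>
  Functions on the space K are taken to be extensional, i.e. equal to \<^const>\<open>undefined\<close> off
  \<^term>\<open>topspace K\<close>, so that equality of elements of C(K) is equality on K.  The scalar field is a
  type variable, to be instantiated with \<^typ>\<open>real\<close> or \<^typ>\<open>complex\<close>.
\<close>

definition Cfun :: "'a topology \<Rightarrow> ('a \<Rightarrow> 'b::real_normed_field) set" where
  "Cfun K = {f \<in> extensional (topspace K). continuous_map K euclidean f}"

text \<open>
  \<^const>\<open>Sup\<close> of the empty set is unspecified on the reals, so this is meaningful for nonempty K
  only.  For empty K there is just one element in C(K), and no uncountable chain.
\<close>

definition sup_norm :: "'a topology \<Rightarrow> ('a \<Rightarrow> 'b::real_normed_field) \<Rightarrow> real" where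
  "sup_norm K f = (SUP t\<in>topspace K. norm (f t))"

definition Cp :: "'a topology \<Rightarrow> ('a \<Rightarrow> 'b::real_normed_field) topology" where
  "Cp K = subtopology (product_topology (\<lambda>t. euclidean) (topspace K)) (Cfun K)"

definition supp :: "'a topology \<Rightarrow> ('a \<Rightarrow> 'b::real_normed_field) \<Rightarrow> 'a set" where
  "supp K f = K closure_of {t \<in> topspace K. f t \<noteq> 0}"

definition prec :: "'a topology \<Rightarrow> ('a \<Rightarrow> 'b::real_normed_field) \<Rightarrow> ('a \<Rightarrow> 'b) \<Rightarrow> bool" where
  "prec K f g \<longleftrightarrow> f \<noteq> g \<and> (\<forall>t\<in>supp K f. f t = g t)"

definition prec_chain :: "'a topology \<Rightarrow> ('a \<Rightarrow> 'b::real_normed_field) set \<Rightarrow> bool" where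
  "prec_chain K F \<longleftrightarrow>
     F \<subseteq> Cfun K \<and> (\<forall>f\<in>F. \<forall>g\<in>F. f \<noteq> g \<longrightarrow> prec K f g \<or> prec K g f)"

definition norm_bounded :: "'a topology \<Rightarrow> ('a \<Rightarrow> 'b::real_normed_field) set \<Rightarrow> bool" where
  "norm_bounded K F \<longleftrightarrow> (\<exists>B. \<forall>f\<in>F. sup_norm K f \<le> B)"

text \<open>
  The infimum is over a nonempty set that is bounded below by 0, since an uncountable chain has two
  distinct elements.
\<close>

definition Bishop_property :: "'b::real_normed_field itself \<Rightarrow> 'a topology \<Rightarrow> bool" where
  "Bishop_property scalars K \<longleftrightarrow>
     (\<forall>F :: ('a \<Rightarrow> 'b) set.
        prec_chain K F \<and> norm_bounded K F \<and> uncountable F \<longrightarrow>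
        Inf {sup_norm K (\<lambda>t. f t - g t) | f g. f \<in> F \<and> g \<in> F \<and> prec K f g} = 0)"

end

theory Submission
  imports Defs
begin

text \<open>
  A Lindelof space contains a condensation point \<open>h\<close> of every uncountable subset, in
  particular of an uncountable \<open>\<prec>\<close>-chain \<open>F\<close>.  At each point the members of \<open>F\<close> take at most one
  nonzero value, so the members of \<open>F\<close> agreeing with \<open>h\<close> on a given finite set are uncountably many.
  Consequently each \<open>f \<in> F\<close> lies below or above \<open>h\<close>, and on each side the compact sets
  \<open>E f = {t. \<epsilon> \<le> norm (f t - h t)}\<close> form a chain.  By compactness the
  nonempty \<open>E f\<close> with \<open>f\<close> below \<open>h\<close> have a common point \<open>s\<close>, and those with \<open>f\<close> above \<open>h\<close> a common
  point \<open>t\<close>.  So every \<open>f\<close> agreeing with \<open>h\<close> at \<open>s\<close> and \<open>t\<close> has \<open>E f = {}\<close>, and two such functions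
  are within \<open>2 * \<epsilon>\<close> of each other.
\<close>

text \<open>Otherwise the open sets meeting \<open>A\<close> in a countable set cover the space, and
  a countable subcover makes \<open>A\<close> countable.\<close>

lemma Lindelof_space_condensation_point:
  assumes "Lindelof_space X" "A \<subseteq> topspace X" "uncountable A"
  obtains x where "x \<in> topspace X" "\<And>U. \<lbrakk>openin X U; x \<in> U\<rbrakk> \<Longrightarrow> uncountable (U \<inter> A)"
proof (rule ccontr)
  assume "\<not> thesis"
  with that have "\<forall>x\<in>topspace X. \<exists>U. openin X U \<and> x \<in> U \<and> countable (U \<inter> A)"
    by blast
  then have "topspace X \<subseteq> \<Union>{U. openin X U \<and> countable (U \<inter> A)}"
    by blast
  then obtain \<V> where \<V>: "countable \<V>" "\<V> \<subseteq> {U. openin X U \<and> countable (U \<inter> A)}"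
      "topspace X \<subseteq> \<Union>\<V>"
    using Lindelof_space_alt[THEN iffD1, OF assms(1), rule_format,
        of "{U. openin X U \<and> countable (U \<inter> A)}"] by blast
  have "countable (\<Union>U\<in>\<V>. U \<inter> A)"
    using \<V> by (intro countable_UN) auto
  moreover have "A \<subseteq> (\<Union>U\<in>\<V>. U \<inter> A)"
    using \<V>(3) assms(2) by blast
  ultimately show False
    using assms(3) countable_subset by blast
qed

text \<open>The intersection of a nonempty finite subfamily of a chain is one of its members, so the
  finite intersection property holds. An empty \<open>\<C>\<close> is allowed, its intersection
  being \<open>UNIV\<close>.\<close>

lemma compact_space_chain_Inter:
  assumes "compact_space X"
    and closed: "\<And>C. C \<in> \<C> \<Longrightarrow> closedin X C"
    and nonempty: "\<And>C. C \<in> \<C> \<Longrightarrow> C \<noteq> {}"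
    and chain: "\<And>C D. \<lbrakk>C \<in> \<C>; D \<in> \<C>\<rbrakk> \<Longrightarrow> C \<subseteq> D \<or> D \<subseteq> C"
  shows "\<Inter>\<C> \<noteq> {}"
proof -
  have "\<Inter>\<F> \<noteq> {}" if "finite \<F>" "\<F> \<subseteq> \<C>" for \<F>
  proof (cases "\<F> = {}")
    case False
    then have "\<Inter>\<F> \<in> \<F>"
      using that chain by (intro finite_Inf_in) (metis in_mono inf.absorb1 inf.absorb2)+
    then show ?thesis
      using nonempty that by blast
  qed auto
  then show ?thesis
    using compact_space_fip[THEN iffD1, OF assms(1), rule_format, of \<C>] closed by auto
qed

lemma Cfun_Diff:
  fixes f g :: "'a \<Rightarrow> 'b::real_normed_field"
  assumes "f \<in> Cfun K" "g \<in> Cfun K"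
  shows "continuous_map K euclidean (\<lambda>t. f t - g t)"
  using assms by (auto simp: Cfun_def intro!: continuous_map_diff)

lemma topspace_Cp [simp]: "topspace (Cp K) = Cfun K"
  by (auto simp: Cp_def Cfun_def PiE_iff extensional_def)

lemma openin_Cp_finite:
  assumes "finite T" "T \<subseteq> topspace K" "\<And>t. t \<in> T \<Longrightarrow> open (V t)"
  shows "openin (Cp K) {f \<in> Cfun K. \<forall>t\<in>T. f t \<in> V t}"
proof -
  have "openin (Cp K) (topspace (Cp K) \<inter> \<Inter>((\<lambda>t. {f \<in> topspace (Cp K). f t \<in> V t}) ` T))"
  proof (intro openin_Int_Inter)
    fix S assume "S \<in> (\<lambda>t. {f \<in> topspace (Cp K). f t \<in> V t}) ` T"
    then obtain t where t: "t \<in> T" "S = {f \<in> topspace (Cp K). f t \<in> V t}"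
      by blast
    have "continuous_map (Cp K) euclidean (\<lambda>f. f t)"
      unfolding Cp_def using assms(2) t(1)
      by (intro continuous_map_from_subtopology continuous_map_product_projection) auto
    then show "openin (Cp K) S"
      using openin_continuous_map_preimage[of "Cp K" euclidean "\<lambda>f. f t" "V t"] t assms(3) by simp
  qed (use assms openin_topspace[of "Cp K"] in auto)
  moreover have "topspace (Cp K) \<inter> \<Inter>((\<lambda>t. {f \<in> topspace (Cp K). f t \<in> V t}) ` T) =
      {f \<in> Cfun K. \<forall>t\<in>T. f t \<in> V t}"
    by auto
  ultimately show ?thesis
    by simp
qed

lemma prec_eq:
  assumes "prec K f g" "t \<in> topspace K" "f t \<noteq> 0"
  shows "g t = f t"
proof -
  have "t \<in> supp K f"
    unfolding supp_def using assms
    by (intro subsetD[OF closure_of_subset]) auto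
  then show ?thesis
    using assms(1) by (simp add: prec_def)
qed

lemma sup_norm_nonneg:
  assumes "compact_space K" "continuous_map K euclidean f" "topspace K \<noteq> {}"
  shows "0 \<le> sup_norm K f"
proof -
  have "compactin euclidean (f ` topspace K)"
    using assms image_compactin unfolding compact_space_def by blast
  then have "bounded (f ` topspace K)"
    by (simp add: compact_imp_bounded)
  then have "bdd_above ((\<lambda>t. norm (f t)) ` topspace K)"
    by (auto simp: bounded_iff intro: bdd_aboveI2)
  moreover obtain t where "t \<in> topspace K"
    using assms(3) by blast
  ultimately show ?thesis
    unfolding sup_norm_def by (intro cSUP_upper2[of _ _ t]) auto
qed

text \<open>The smaller of the two functions is nonzero at \<open>t\<close>, so the larger one
  copies its value there.\<close>

lemma prec_chain_eq:
  assumes "prec_chain K F" "f \<in> F" "g \<in> F" "t \<in> topspace K" "f t \<noteq> 0" "g t \<noteq> 0"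
  shows "f t = g t"
proof (cases "f = g")
  case False
  then have "prec K f g \<or> prec K g f"
    using assms(1-3) by (auto simp: prec_chain_def)
  then show ?thesis
    using prec_eq[of K f g t] prec_eq[of K g f t] assms(4-6) by auto
qed simp

lemma Lindelof_Cp_condensation_point:
  fixes F :: "('a \<Rightarrow> 'b::real_normed_field) set"
  assumes "Lindelof_space (Cp K :: ('a \<Rightarrow> 'b) topology)" "prec_chain K F" "uncountable F"
  obtains h where "h \<in> Cfun K"
    "\<And>T. \<lbrakk>finite T; T \<subseteq> topspace K\<rbrakk> \<Longrightarrow> uncountable {f \<in> F. \<forall>t\<in>T. f t = h t}"
proof -
  have F: "F \<subseteq> Cfun K"
    using assms(2) by (simp add: prec_chain_def)
  obtain h where h: "h \<in> Cfun K" "\<And>U. \<lbrakk>openin (Cp K) U; h \<in> U\<rbrakk> \<Longrightarrow> uncountable (U \<inter> F)"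
    using Lindelof_space_condensation_point[OF assms(1) _ assms(3)] F by auto
  have "uncountable {f \<in> F. \<forall>t\<in>T. f t = h t}" if T: "finite T" "T \<subseteq> topspace K" for T
  proof -
    \<comment> \<open>\<open>V t\<close> omits every value other than \<open>h t\<close> that
      \<open>F\<close> takes at \<open>t\<close>. Only finitely many values are omitted, so
      \<open>V t\<close> is open, and for members of \<open>F\<close> lying in \<open>V t\<close> at
      \<open>t\<close> means equality with \<open>h t\<close>.\<close>
    define V where "V t = - ((\<lambda>f. f t) ` F - {h t})" for t
    have "open (V t)" if "t \<in> T" for t
    proof -
      have "\<exists>c. (\<lambda>f. f t) ` F \<subseteq> {0, c}"
        using prec_chain_eq[OF assms(2)] T that by blast
      then have "finite ((\<lambda>f. f t) ` F)"
        by (meson finite.simps finite_subset)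
      then show ?thesis
        unfolding V_def by (intro open_Compl finite_imp_closed) auto
    qed
    then have "openin (Cp K) {f \<in> Cfun K. \<forall>t\<in>T. f t \<in> V t}"
      using T by (intro openin_Cp_finite)
    then have "uncountable ({f \<in> Cfun K. \<forall>t\<in>T. f t \<in> V t} \<inter> F)"
      using h by (simp add: V_def)
    moreover have "{f \<in> Cfun K. \<forall>t\<in>T. f t \<in> V t} \<inter> F = {f \<in> F. \<forall>t\<in>T. f t = h t}"
      using F by (auto simp: V_def)
    ultimately show ?thesis
      by simp
  qed
  with h(1) that show thesis
    by blast
qed

lemma prec_chain_close_pair:
  fixes F :: "('a \<Rightarrow> 'b::real_normed_field) set"
  assumes "compact_space K" and chain: "prec_chain K F" and h: "h \<in> Cfun K"
    and agree: "\<And>T. \<lbrakk>finite T; T \<subseteq> topspace K\<rbrakk> \<Longrightarrow> uncountable {f \<in> F. \<forall>t\<in>T. f t = h t}"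
    and "0 < \<epsilon>"
  obtains f g where "f \<in> F" "g \<in> F" "prec K f g"
    "\<And>t. t \<in> topspace K \<Longrightarrow> norm (f t - g t) \<le> 2 * \<epsilon>"
proof -
  define E where "E f = {t \<in> topspace K. \<epsilon> \<le> norm (f t - h t)}" for f
  \<comment> \<open>\<open>A\<close> and \<open>B\<close> hold the members below and above
    \<open>h\<close>. Both conditions admit \<open>h\<close> itself, which may or may not belong to
    \<open>F\<close>.\<close>
  define A where "A = {f \<in> F. \<forall>t\<in>topspace K. f t \<noteq> 0 \<longrightarrow> f t = h t}"
  define B where "B = {f \<in> F. \<forall>t\<in>topspace K. h t \<noteq> 0 \<longrightarrow> f t = h t}"
  have F: "F \<subseteq> Cfun K" and cmp: "\<And>f g. \<lbrakk>f \<in> F; g \<in> F; f \<noteq> g\<rbrakk> \<Longrightarrow> prec K f g \<or> prec K g f"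
    using chain by (auto simp: prec_chain_def)
  have uncountable_ex: "\<exists>x\<in>S. x \<noteq> y" if "uncountable S" for S :: "('a \<Rightarrow> 'b) set" and y
    using that by (metis countable_empty countable_insert countable_subset insertCI subsetI)
  have AB: "F \<subseteq> A \<union> B"
  proof
    fix f assume f: "f \<in> F"
    show "f \<in> A \<union> B"
    proof (rule ccontr)
      assume "f \<notin> A \<union> B"
      then obtain s t where st: "s \<in> topspace K" "f s \<noteq> 0" "f s \<noteq> h s"
          "t \<in> topspace K" "h t \<noteq> 0" "f t \<noteq> h t"
        using f by (auto simp: A_def B_def)
      \<comment> \<open>This \<open>g\<close> is incomparable with \<open>f\<close>:
        \<open>prec K f g\<close> would force \<open>f s = g s = h s\<close>, and
        \<open>prec K g f\<close> would force \<open>f t = g t = h t\<close>.\<close>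
      obtain g where g: "g \<in> F" "g s = h s" "g t = h t"
        using uncountable_ex[OF agree[of "{s, t}"]] st by auto
      show False
        using cmp[OF f g(1)] prec_eq[of K f g s] prec_eq[of K g f t] g st by metis
    qed
  qed
  have closed: "closedin K (E f)" if "f \<in> F" for f
  proof -
    have "continuous_map K euclidean (\<lambda>t. norm (f t - h t))"
      using Cfun_Diff[of f K h] F h that by (intro continuous_map_norm) auto
    from closedin_continuous_map_preimage[OF this, of "{\<epsilon>..}"] show ?thesis
      by (simp add: E_def)
  qed
  \<comment> \<open>Below \<open>h\<close>, a member can differ from \<open>h\<close> only where it
    vanishes, and where the larger function vanishes so does the smaller.\<close>
  have antimono: "E g \<subseteq> E f" if "f \<in> A" "g \<in> A" "prec K f g" for f g
  proof
    fix t assume t: "t \<in> E g"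
    then have "g t = 0"
      using that \<open>0 < \<epsilon>\<close> by (auto simp: A_def E_def)
    then have "f t = 0"
      using prec_eq[OF that(3), of t] t by (force simp: E_def)
    then show "t \<in> E f"
      using t \<open>g t = 0\<close> by (simp add: E_def)
  qed
  \<comment> \<open>Above \<open>h\<close> the inclusion reverses: a member can differ from
    \<open>h\<close> only where \<open>h\<close> is zero and the member is not, and there every
    larger member has the same value.\<close>
  have mono: "E f \<subseteq> E g" if "f \<in> B" "g \<in> B" "prec K f g" for f g
  proof
    fix t assume t: "t \<in> E f"
    then have "h t = 0" "f t \<noteq> 0"
      using that \<open>0 < \<epsilon>\<close> by (auto simp: B_def E_def)
    then show "t \<in> E g"
      using t prec_eq[OF that(3)] by (auto simp: E_def)
  qed
  have hit: "\<exists>s. \<forall>f\<in>C. E f \<noteq> {} \<longrightarrow> s \<in> E f"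
    if "C \<subseteq> F" and nest: "\<And>f g. \<lbrakk>f \<in> C; g \<in> C; prec K f g\<rbrakk> \<Longrightarrow> E f \<subseteq> E g \<or> E g \<subseteq> E f" for C
  proof -
    have "\<Inter>{E f |f. f \<in> C \<and> E f \<noteq> {}} \<noteq> {}"
    proof (rule compact_space_chain_Inter[OF assms(1)])
      fix P Q assume "P \<in> {E f |f. f \<in> C \<and> E f \<noteq> {}}" "Q \<in> {E f |f. f \<in> C \<and> E f \<noteq> {}}"
      then show "P \<subseteq> Q \<or> Q \<subseteq> P"
        using nest cmp that(1) by (smt (verit) mem_Collect_eq order_refl subsetD)
    qed (use closed that(1) in auto)
    then show ?thesis
      by blast
  qed
  obtain s where s: "\<forall>f\<in>A. E f \<noteq> {} \<longrightarrow> s \<in> E f"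
    using hit[of A] antimono by (auto simp: A_def)
  obtain t where t: "\<forall>f\<in>B. E f \<noteq> {} \<longrightarrow> t \<in> E f"
    using hit[of B] mono by (auto simp: B_def)
  \<comment> \<open>If every \<open>E f\<close> on one side is empty, the corresponding point is
    arbitrary and may lie outside \<open>K\<close>; hence the intersection with
    \<open>topspace K\<close>.\<close>
  define G where "G = {f \<in> F. \<forall>r \<in> {s, t} \<inter> topspace K. f r = h r}"
  have "uncountable G"
    unfolding G_def by (intro agree) auto
  have E_empty: "E f = {}" if "f \<in> G" for f
  proof (rule ccontr)
    assume "E f \<noteq> {}"
    then have "s \<in> E f \<or> t \<in> E f"
      using that AB s t by (auto simp: G_def)
    then show False
      using that \<open>0 < \<epsilon>\<close> by (auto simp: G_def E_def)
  qed
  have close: "norm (f r - g r) \<le> 2 * \<epsilon>" if "f \<in> G" "g \<in> G" "r \<in> topspace K" for f g r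
  proof -
    have "norm (f r - h r) < \<epsilon>" "norm (g r - h r) < \<epsilon>"
      using E_empty[OF that(1)] E_empty[OF that(2)] that(3) by (auto simp: E_def not_le)
    then show ?thesis
      using norm_triangle_ineq4[of "f r - h r" "g r - h r"] by simp
  qed
  obtain f g where "f \<in> G" "g \<in> G" "f \<noteq> g"
    using uncountable_ex[OF \<open>uncountable G\<close>] by metis
  moreover from this have "prec K f g \<or> prec K g f"
    by (intro cmp) (auto simp: G_def)
  ultimately show thesis
    using that close by (metis (no_types, lifting) G_def mem_Collect_eq)
qed

text \<open>The scalar field is kept general so that the real and complex cases are both
  instances.\<close>

theorem Lindelof_Cp_imp_Bishop_property:
  fixes K :: "'a topology"
  assumes "compact_space K" "Lindelof_space (Cp K :: ('a \<Rightarrow> 'b::real_normed_field) topology)"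
  shows "Bishop_property TYPE('b) K"
  unfolding Bishop_property_def
proof (intro allI impI, elim conjE)
  fix F :: "('a \<Rightarrow> 'b) set"
  assume chain: "prec_chain K F" and "uncountable F"
  have F: "F \<subseteq> Cfun K"
    using chain by (simp add: prec_chain_def)
  obtain h where h: "h \<in> Cfun K"
    "\<And>T. \<lbrakk>finite T; T \<subseteq> topspace K\<rbrakk> \<Longrightarrow> uncountable {f \<in> F. \<forall>t\<in>T. f t = h t}"
    using Lindelof_Cp_condensation_point[OF assms(2) chain \<open>uncountable F\<close>] by blast
  have "topspace K \<noteq> {}"
  proof
    assume "topspace K = {}"
    then have "F \<subseteq> {\<lambda>_. undefined}"
      using F by (auto simp: Cfun_def)
    then show False
      using \<open>uncountable F\<close> countable_subset by fastforce
  qed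
  define S where "S = {sup_norm K (\<lambda>t. f t - g t) | f g. f \<in> F \<and> g \<in> F \<and> prec K f g}"
  have nonneg: "0 \<le> x" if "x \<in> S" for x
    using that F assms(1) \<open>topspace K \<noteq> {}\<close>
    by (auto simp: S_def intro!: sup_norm_nonneg Cfun_Diff)
  have small: "\<exists>x\<in>S. x \<le> 2 * \<epsilon>" if "0 < \<epsilon>" for \<epsilon>
  proof -
    obtain f g where fg: "f \<in> F" "g \<in> F" "prec K f g"
      "\<And>t. t \<in> topspace K \<Longrightarrow> norm (f t - g t) \<le> 2 * \<epsilon>"
      using prec_chain_close_pair[OF assms(1) chain h \<open>0 < \<epsilon>\<close>] by blast
    then have "sup_norm K (\<lambda>t. f t - g t) \<le> 2 * \<epsilon>"
      unfolding sup_norm_def using \<open>topspace K \<noteq> {}\<close> by (intro cSUP_least)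
    then show ?thesis
      using fg(1-3) by (auto simp: S_def)
  qed
  have "Inf S \<le> 0 + \<epsilon>" if "0 < \<epsilon>" for \<epsilon>
  proof -
    obtain x where "x \<in> S" "x \<le> 2 * (\<epsilon> / 2)"
      using small[of "\<epsilon> / 2"] \<open>0 < \<epsilon>\<close> by auto
    moreover have "bdd_below S"
      using nonneg by (rule bdd_belowI)
    ultimately show ?thesis
      using cInf_lower[of x S] by simp
  qed
  then have "Inf S \<le> 0"
    by (rule field_le_epsilon)
  \<comment> \<open>\<open>small\<close> serves here only to show that \<open>S\<close> is nonempty,
    as \<open>cInf_greatest\<close> requires.\<close>
  moreover have "0 \<le> Inf S"
    using small[of 1] nonneg by (intro cInf_greatest) auto
  ultimately show "Inf {sup_norm K (\<lambda>t. f t - g t) | f g. f \<in> F \<and> g \<in> F \<and> prec K f g} = 0"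
    by (simp add: S_def)
qed

theorem mainTheorem2:
  fixes K :: "'a topology"
  assumes "compact_space K" and "Hausdorff_space K"
  shows "(Lindelof_space (Cp K :: ('a \<Rightarrow> real) topology) \<longrightarrow> Bishop_property TYPE(real) K) \<and>
         (Lindelof_space (Cp K :: ('a \<Rightarrow> complex) topology) \<longrightarrow> Bishop_property TYPE(complex) K)"
  using Lindelof_Cp_imp_Bishop_property[where 'b = real, OF assms(1)]
    Lindelof_Cp_imp_Bishop_property[where 'b = complex, OF assms(1)] by (intro conjI impI)

end
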